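(* Let $L$ be an even lattice of rank $n$. Then the following conditions are equivalent: (1) $L$ is obtained by Construction B. (2) The set $$R_L=\Big\{\lambda+L\in L^*/L\ \Big|\ \lambda\in L/2,\ |(\lambda+L)_2|\ge 2n+|L_2|\Big\}$$ is not empty.
   Context: Lattices are positive-definite; a lattice is even if all its vectors have even norm $\langle v,v\rangle$. $L^*$ is the dual lattice, $L/2=\{v/2: v\in L\}$, and for a subset $U$ of a Euclidean space $U_m$ is the set of vectors $v\in U$ with $\langle v,v\rangle=m$. Construction B: let $\Omega_n=\{1,\dots,n\}$, let $\{\alpha_i\mid i\in\Omega_n\}$ be an orthogonal basis of $\mathbb{R}^n$ with $\langle\alpha_i,\alpha_j\rangle=2\delta_{i,j}$, and put $\alpha_J=\sum_{i\in J}\alpha_i$ for $J\subset\Omega_n$. For a linear binary code $C$ of length $n$ (codewords viewed as subsets of $\Omega_n$), $L_B(C)=\sum_{c\in C}\mathbb{Z}\tfrac12\alpha_c+\sum_{i,j\in\Omega_n}\mathbb{Z}(\alpha_i+\alpha_j)$. A lattice is obtained by Construction B if it is isometric to $L_B(C)$ for some such $C$ (the lattice $L_B(C)$ is even if and only if all weights of $C$ are divisible by $4$). *)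

theory Defs
  imports "HOL-Analysis.Analysis" "HOL-Computational_Algebra.Group_Closure"
begin

(* group_closure S is the additive subgroup generated by S, that is, the set of all
   integral linear combinations of elements of S.  Positive definiteness of a lattice is
   that of the ambient inner product.  A lattice need not span the ambient space; every
   lattice of rank n lives in the n-dimensional Euclidean space "span L". *)
definition lattice_of_rank :: "nat \<Rightarrow> 'a::euclidean_space set \<Rightarrow> bool" where
  "lattice_of_rank n L \<longleftrightarrow> (\<exists>B. independent B \<and> card B = n \<and> L = group_closure B)"

definition even_lattice_of_rank :: "nat \<Rightarrow> 'a::euclidean_space set \<Rightarrow> bool" where
  "even_lattice_of_rank n L \<longleftrightarrow>
     lattice_of_rank n L \<and> (\<forall>v\<in>L. \<exists>k::int. v \<bullet> v = 2 * of_int k)"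

definition dual_lattice :: "'a::euclidean_space set \<Rightarrow> 'a set" where
  "dual_lattice L = {x \<in> span L. \<forall>v\<in>L. x \<bullet> v \<in> \<int>}"

definition half_lattice :: "'a::euclidean_space set \<Rightarrow> 'a set" where
  "half_lattice L = (\<lambda>v. (1/2) *\<^sub>R v) ` L"

definition vectors_of_norm :: "'a::euclidean_space set \<Rightarrow> real \<Rightarrow> 'a set" where
  "vectors_of_norm U m = {v \<in> U. v \<bullet> v = m}"

definition coset_of :: "'a::euclidean_space \<Rightarrow> 'a set \<Rightarrow> 'a set" where
  "coset_of x L = (\<lambda>v. x + v) ` L"

(* Cosets of a lattice are discrete, so the sets whose cardinality is taken are finite. *)
definition R_set :: "nat \<Rightarrow> 'a::euclidean_space set \<Rightarrow> 'a set set" where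
  "R_set n L = {coset_of x L | x. x \<in> dual_lattice L \<and> x \<in> half_lattice L \<and>
     card (vectors_of_norm (coset_of x L) 2) \<ge> 2 * n + card (vectors_of_norm L 2)}"

definition isometric_lattices :: "'a::euclidean_space set \<Rightarrow> 'b::euclidean_space set \<Rightarrow> bool" where
  "isometric_lattices L M \<longleftrightarrow>
     (\<exists>f. bij_betw f L M \<and> (\<forall>x\<in>L. \<forall>y\<in>L. f (x + y) = f x + f y)
        \<and> (\<forall>x\<in>L. \<forall>y\<in>L. f x \<bullet> f y = x \<bullet> y))"

(* Codewords are identified with their supports, so addition is symmetric difference. *)
definition linear_code :: "nat \<Rightarrow> nat set set \<Rightarrow> bool" where
  "linear_code n C \<longleftrightarrow> C \<subseteq> Pow {1..n} \<and> {} \<in> C \<and> (\<forall>c\<in>C. \<forall>d\<in>C. (c - d) \<union> (d - c) \<in> C)"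

(* Such a family is linearly independent, hence an orthogonal basis of the n-dimensional
   Euclidean space spanned by \<alpha> 1, ..., \<alpha> n, which plays the role of R^n. *)
definition norm2_orthogonal_basis :: "nat \<Rightarrow> (nat \<Rightarrow> 'b::euclidean_space) \<Rightarrow> bool" where
  "norm2_orthogonal_basis n \<alpha> \<longleftrightarrow>
     (\<forall>i\<in>{1..n}. \<forall>j\<in>{1..n}. \<alpha> i \<bullet> \<alpha> j = (if i = j then 2 else 0))"

definition L_B :: "nat \<Rightarrow> (nat \<Rightarrow> 'b::euclidean_space) \<Rightarrow> nat set set \<Rightarrow> 'b set" where
  "L_B n \<alpha> C = group_closure
     ({(1/2) *\<^sub>R (\<Sum>i\<in>c. \<alpha> i) | c. c \<in> C} \<union> {\<alpha> i + \<alpha> j | i j. i \<in> {1..n} \<and> j \<in> {1..n}})"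

definition obtained_by_construction_B ::
  "nat \<Rightarrow> (nat \<Rightarrow> 'b::euclidean_space) \<Rightarrow> 'a::euclidean_space set \<Rightarrow> bool" where
  "obtained_by_construction_B n \<alpha> L \<longleftrightarrow>
     (\<exists>C. linear_code n C \<and> isometric_lattices L (L_B n \<alpha> C))"

end

theory Submission
  imports Defs
begin

text \<open>Let S be the set of norm 2 vectors in the coset of \<open>\<mu>\<close>, where \<open>\<mu>\<close> lies in the dual
  lattice and \<open>2\<mu>\<close> in L. If a, b in S are neither orthogonal nor parallel, the reflection of b in a
  is a norm 2 vector of L, and conversely. So if S has at least 2n elements more than L has norm 2
  vectors, orthogonal vectors can be picked from S one by one, the excess dropping by at most 2 each
  time, until they form an orthogonal basis. After sign changes, the sum of the coordinates
  \<open>\<langle>v, \<beta>\<^sub>i\<rangle>\<close> is divisible by 4 for all v in L, which identifies L with the lattice of the code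
  consisting of the sets of odd coordinates. Conversely, in a lattice from Construction B the
  coset of \<open>\<alpha>\<^sub>1\<close> contains the 2n vectors \<open>\<plusminus>\<alpha>\<^sub>i\<close> and a reflection of every norm 2 vector of L.\<close>

section \<open>Norm 2 vectors and coordinates in orthogonal bases of such vectors\<close>

lemma norm2_inner_cases:
  fixes x y :: "'a::real_inner"
  assumes "x \<bullet> x = 2" "y \<bullet> y = 2" "x \<bullet> y \<in> \<int>"
  obtains "x = y" | "x = - y" | "x \<bullet> y = 0" | "x \<bullet> y = 1" | "x \<bullet> y = -1"
proof -
  obtain k :: int where k: "x \<bullet> y = of_int k" using assms(3) by (auto elim: Ints_cases)
  \<comment> \<open>Nonnegativity of both norms bounds k by 2 in absolute value, and at the extremes
    one of the two vectors vanishes.\<close>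
  have minus: "(x - y) \<bullet> (x - y) = 4 - 2 * of_int k" and plus: "(x + y) \<bullet> (x + y) = 4 + 2 * of_int k"
    using assms k by (simp_all add: inner_diff inner_add inner_commute)
  have "0 \<le> (x - y) \<bullet> (x - y)" "0 \<le> (x + y) \<bullet> (x + y)" by simp_all
  then have "k \<le> 2" "-2 \<le> k" using minus plus by linarith+
  moreover have "k = 2 \<Longrightarrow> x = y" using minus by simp
  moreover have "k = -2 \<Longrightarrow> x = - y" using plus inner_eq_zero_iff[of "x + y"] by (simp add: eq_neg_iff_add_eq_0 del: inner_eq_zero_iff)
  ultimately show thesis using k that by (cases "k = 2 \<or> k = -2 \<or> k = 0 \<or> k = 1") auto
qed

text \<open>A vector of the span is determined by its inner products with \<open>B\<close>. These
  are integers, bounded by Cauchy-Schwarz since the norm is fixed, so finitely many choices remain.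
  Finiteness matters because \<open>card\<close> is 0 on infinite sets.\<close>

lemma finite_norm2_integral:
  fixes B :: "'a::euclidean_space set"
  assumes "finite B" and X: "\<And>x. x \<in> X \<Longrightarrow> x \<in> span B \<and> x \<bullet> x = 2 \<and> (\<forall>b\<in>B. x \<bullet> b \<in> \<int>)"
  shows "finite X"
proof -
  obtain K where K: "\<And>b. b \<in> B \<Longrightarrow> norm b \<le> K"
    using \<open>finite B\<close> by (meson bounded_iff finite_imp_bounded)
  define F where "F = (\<lambda>x. restrict (\<lambda>b. x \<bullet> b) B)"
  have "F x \<in> B \<rightarrow>\<^sub>E {k \<in> \<int>. \<bar>k\<bar> \<le> sqrt 2 * K}" if "x \<in> X" for x
  proof -
    have "norm x = sqrt 2" using X[OF that] by (simp add: norm_eq_sqrt_inner)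
    then have "\<bar>x \<bullet> b\<bar> \<le> sqrt 2 * K" if "b \<in> B" for b
      using Cauchy_Schwarz_ineq2[of x b] K[OF that]
      by (metis mult_left_mono norm_ge_zero order_trans)
    then show ?thesis using X[OF that] by (auto simp: F_def)
  qed
  moreover have "finite (B \<rightarrow>\<^sub>E {k::real. k \<in> \<int> \<and> \<bar>k\<bar> \<le> sqrt 2 * K})"
    by (intro finite_PiE \<open>finite B\<close> finite_abs_int_segment)
  ultimately have "finite (F ` X)" by (meson finite_subset image_subsetI)
  moreover have "inj_on F X"
  proof
    fix x y assume xy: "x \<in> X" "y \<in> X" "F x = F y"
    then have "x \<bullet> b = y \<bullet> b" if "b \<in> B" for b using that by (metis F_def restrict_apply')
    then have "orthogonal (x - y) b" if "b \<in> B" for b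
      using that by (simp add: orthogonal_def inner_diff_left)
    moreover have "x - y \<in> span B" using X xy by (simp add: span_diff)
    ultimately have "orthogonal (x - y) (x - y)" using orthogonal_to_span by blast
    then have "x - y = 0" by (simp only: orthogonal_self)
    then show "x = y" by simp
  qed
  ultimately show ?thesis using finite_imageD by blast
qed

text \<open>Squares are 0 or 1 mod 4 according to parity. This turns evenness of the norm of a
  lattice vector into divisibility by 4 of its number of odd coordinates.\<close>

lemma sum_squares_mod_4:
  fixes x :: "'i \<Rightarrow> int"
  assumes "finite I"
  shows "4 dvd (\<Sum>i\<in>I. (x i)\<^sup>2) - int (card {i\<in>I. odd (x i)})"
proof -
  have "4 dvd (x i)\<^sup>2 - (if odd (x i) then 1 else 0)" for i
  proof (cases "odd (x i)")
    case True
    then obtain k where "x i = 2 * k + 1" by (auto elim: oddE)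
    then have "(x i)\<^sup>2 - 1 = 4 * (k\<^sup>2 + k)" by (simp add: power2_eq_square algebra_simps)
    with True show ?thesis by simp
  next
    case False
    then obtain k where "x i = 2 * k" by auto
    with False show ?thesis by (simp add: power_mult_distrib)
  qed
  then have "4 dvd (\<Sum>i\<in>I. (x i)\<^sup>2 - (if odd (x i) then 1 else 0))"
    by (intro dvd_sum)
  moreover have "(\<Sum>i\<in>I. if odd (x i) then 1 else 0) = int (card {i\<in>I. odd (x i)})"
    using assms by (simp add: sum.If_cases Int_def)
  ultimately show ?thesis by (simp add: sum_subtractf)
qed

lemma norm2_basis_inner_sum:
  assumes "norm2_orthogonal_basis n \<beta>" "j \<in> {1..n}" "I \<subseteq> {1..n}"
  shows "(\<Sum>i\<in>I. a i *\<^sub>R \<beta> i) \<bullet> \<beta> j = (if j \<in> I then 2 * a j else 0)"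
proof -
  have "finite I" using assms(3) finite_subset by blast
  have "(\<Sum>i\<in>I. a i *\<^sub>R \<beta> i) \<bullet> \<beta> j = (\<Sum>i\<in>I. if i = j then 2 * a i else 0)"
    unfolding inner_sum_left using assms
    by (intro sum.cong) (auto simp: norm2_orthogonal_basis_def subset_iff)
  then show ?thesis using \<open>finite I\<close> by simp
qed

text \<open>Each coefficient is an inner product divided by the norm 2. The difference of the two
  sides lies in the span and is orthogonal to all of it.\<close>

lemma norm2_basis_expand:
  assumes \<beta>: "norm2_orthogonal_basis n \<beta>" and v: "v \<in> span (\<beta> ` {1..n})"
  shows "v = (\<Sum>i\<in>{1..n}. (v \<bullet> \<beta> i / 2) *\<^sub>R \<beta> i)" (is "v = ?w")
proof -
  have "?w \<in> span (\<beta> ` {1..n})" by (intro span_sum span_scale span_base) auto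
  then have "v - ?w \<in> span (\<beta> ` {1..n})" using v by (rule span_diff[rotated])
  moreover have "orthogonal (v - ?w) b" if "b \<in> \<beta> ` {1..n}" for b
    using that norm2_basis_inner_sum[OF \<beta> _ order.refl]
    by (auto simp: orthogonal_def inner_diff_left)
  ultimately have "orthogonal (v - ?w) (v - ?w)" using orthogonal_to_span by blast
  then have "v - ?w = 0" by (simp only: orthogonal_self)
  then show ?thesis by simp
qed

lemma norm2_basis_inner:
  assumes \<beta>: "norm2_orthogonal_basis n \<beta>" and v: "v \<in> span (\<beta> ` {1..n})"
  shows "u \<bullet> v = (\<Sum>i\<in>{1..n}. (u \<bullet> \<beta> i) * (v \<bullet> \<beta> i)) / 2"
  by (subst norm2_basis_expand[OF assms]) (simp add: inner_sum_right sum_divide_distrib mult.commute)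

lemma norm2_basis_independent:
  assumes "norm2_orthogonal_basis n \<beta>"
  shows "independent (\<beta> ` {1..n})" "inj_on \<beta> {1..n}"
proof -
  have d: "\<beta> i \<bullet> \<beta> j = (if i = j then 2 else 0)" if "i \<in> {1..n}" "j \<in> {1..n}" for i j
    using assms that by (simp add: norm2_orthogonal_basis_def)
  show "inj_on \<beta> {1..n}"
  proof
    fix i j assume ij: "i \<in> {1..n}" "j \<in> {1..n}" "\<beta> i = \<beta> j"
    then have "\<beta> i \<bullet> \<beta> j = 2" using d[of i i] by simp
    then show "i = j" using d[OF ij(1,2)] by (simp split: if_splits)
  qed
  have "pairwise orthogonal (\<beta> ` {1..n})"
    unfolding pairwise_def orthogonal_def using d by auto
  moreover have "0 \<notin> \<beta> ` {1..n}"
  proof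
    assume "0 \<in> \<beta> ` {1..n}"
    then obtain i where "i \<in> {1..n}" "\<beta> i = 0" by auto
    then show False using d[of i i] by simp
  qed
  ultimately show "independent (\<beta> ` {1..n})" by (rule pairwise_orthogonal_independent)
qed

section \<open>Additive subgroups, even groups and parity\<close>

locale additive_subgroup =
  fixes L :: "'a::real_vector set"
  assumes zero: "0 \<in> L" and diff: "\<And>x y. x \<in> L \<Longrightarrow> y \<in> L \<Longrightarrow> x - y \<in> L"
begin

lemma minus: "x \<in> L \<Longrightarrow> - x \<in> L"
  using diff[OF zero, of x] by simp

lemma add: "x \<in> L \<Longrightarrow> y \<in> L \<Longrightarrow> x + y \<in> L"
  using diff[OF _ minus, of x y] by simp

lemma sum: "(\<And>i. i \<in> I \<Longrightarrow> f i \<in> L) \<Longrightarrow> (\<Sum>i\<in>I. f i) \<in> L"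
  by (induction I rule: infinite_finite_induct) (auto intro: zero add)

lemma of_int_scale: "x \<in> L \<Longrightarrow> of_int k *\<^sub>R x \<in> L"
proof (induction k rule: int_induct[where k = 0])
  case base
  show ?case using zero by simp
next
  case (step1 i)
  then show ?case by (simp add: algebra_simps add)
next
  case (step2 i)
  then show ?case by (simp add: algebra_simps diff)
qed

text \<open>For a fixed index e, the vectors \<open>\<beta> i - \<beta> e\<close> and
  \<open>\<beta> e + \<beta> e\<close> lie in \<open>L\<close>. Writing each
  \<open>\<beta> i\<close> as \<open>\<beta> e\<close> plus such a difference leaves
  \<open>\<beta> e\<close> with the even total coefficient.\<close>

lemma even_combination:
  assumes "\<And>i j. i \<in> I \<Longrightarrow> j \<in> I \<Longrightarrow> \<beta> i + \<beta> j \<in> L" and "even (\<Sum>i\<in>I. m i)"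
  shows "(\<Sum>i\<in>I. of_int (m i) *\<^sub>R \<beta> i) \<in> L"
proof (cases "I = {}")
  case False
  then obtain e where e: "e \<in> I" by auto
  obtain k where k: "(\<Sum>i\<in>I. m i) = 2 * k" using assms(2) by auto
  have "\<beta> i - \<beta> e \<in> L" if "i \<in> I" for i
    using diff[OF assms(1)[OF that e] assms(1)[OF e e]] by simp
  then have "(\<Sum>i\<in>I. of_int (m i) *\<^sub>R (\<beta> i - \<beta> e)) + of_int k *\<^sub>R (\<beta> e + \<beta> e) \<in> L"
    by (intro add sum of_int_scale assms(1) e)
  also have "of_int k *\<^sub>R (\<beta> e + \<beta> e) = of_int (2 * k) *\<^sub>R \<beta> e"
    by (simp add: algebra_simps scaleR_2[symmetric])
  also have "\<dots> = (\<Sum>i\<in>I. of_int (m i) *\<^sub>R \<beta> e)"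
    by (simp add: k[symmetric] scaleR_left.sum)
  finally show ?thesis by (simp add: scaleR_diff_right sum_subtractf)
qed (simp add: zero)

text \<open>Applied not only to lattices but also to spans and to sets cut out by an integrality
  condition, which then needs checking on generators only.\<close>

lemma group_closure_subset: "X \<subseteq> L \<Longrightarrow> group_closure X \<subseteq> L"
proof
  fix x assume "X \<subseteq> L" "x \<in> group_closure X"
  from this(2,1) show "x \<in> L" by induction (auto intro: zero diff)
qed

end

lemma additive_subgroup_group_closure: "additive_subgroup (group_closure X)"
  by unfold_locales (auto intro: group_closure.diff)

lemma group_closure_subset_span: "group_closure B \<subseteq> span B"
proof -
  interpret additive_subgroup "span B" by unfold_locales (auto intro: span_diff span_zero)
  show ?thesis by (rule group_closure_subset) (rule span_superset)
qed

locale even_group = additive_subgroup L for L :: "'a::euclidean_space set" +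
  assumes even: "\<And>v. v \<in> L \<Longrightarrow> \<exists>k::int. v \<bullet> v = 2 * of_int k"
begin

text \<open>Polarisation: twice the inner product is the norm of \<open>u + v\<close> minus the
  norms of u and v, and all three are even.\<close>

lemma integral:
  assumes "u \<in> L" "v \<in> L"
  shows "u \<bullet> v \<in> \<int>"
proof -
  obtain a b c :: int where "u \<bullet> u = 2 * of_int a" "v \<bullet> v = 2 * of_int b" "(u + v) \<bullet> (u + v) = 2 * of_int c"
    using assms even add by metis
  then have "u \<bullet> v = of_int (c - a - b)" by (simp add: inner_add inner_commute)
  then show ?thesis by simp
qed

end

text \<open>Parity is expressed below as integrality of the half, so that coordinates can remain
  real numbers.\<close>

lemma half_of_int_in_Ints_iff: "(of_int k / 2 :: real) \<in> \<int> \<longleftrightarrow> even k"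
proof
  assume "(of_int k / 2 :: real) \<in> \<int>"
  then obtain j where "(of_int k / 2 :: real) = of_int j" by (auto elim: Ints_cases)
  then have "(of_int k :: real) = of_int (2 * j)" by simp
  then show "even k" by (simp only: of_int_eq_iff) simp
qed auto

lemma half_diff_in_Ints:
  fixes x y :: real
  assumes "x \<in> \<int>" "y \<in> \<int>" "x / 2 \<notin> \<int>" "y / 2 \<notin> \<int>"
  shows "(x - y) / 2 \<in> \<int>"
proof -
  obtain j k where "x = of_int j" "y = of_int k" using assms(1,2) by (auto elim!: Ints_cases)
  then show ?thesis
    using assms(3,4) half_of_int_in_Ints_iff[of j] half_of_int_in_Ints_iff[of k]
      half_of_int_in_Ints_iff[of "j - k"] by simp
qed

lemma Ints_diff_imp_iff:
  fixes x y :: "'a::ring_1"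
  shows "x - y \<in> \<int> \<Longrightarrow> x \<in> \<int> \<longleftrightarrow> y \<in> \<int>"
  using Ints_add[of "x - y" y] Ints_diff[of x "x - y"] by auto

section \<open>Norm 2 vectors in a coset of order at most two\<close>

locale glued_group = even_group L for L :: "'a::euclidean_space set" +
  fixes \<mu> :: 'a
  assumes twice: "\<mu> + \<mu> \<in> L" and dual: "\<And>v. v \<in> L \<Longrightarrow> \<mu> \<bullet> v \<in> \<int>"
begin

text \<open>By \<open>S_eq_coset\<close> this is
  \<open>vectors_of_norm (coset_of \<mu> L) 2\<close>. The membership form reduces statements on
  sums and differences directly to closure of \<open>L\<close>.\<close>

definition S :: "'a set" where "S = {x. x - \<mu> \<in> L \<and> x \<bullet> x = 2}"

lemma S_diff: "a \<in> S \<Longrightarrow> b \<in> S \<Longrightarrow> a - b \<in> L"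
  using diff[of "a - \<mu>" "b - \<mu>"] by (simp add: S_def)

lemma S_add: "a \<in> S \<Longrightarrow> b \<in> S \<Longrightarrow> a + b \<in> L"
  using add[OF add[of "a - \<mu>" "b - \<mu>"] twice] by (simp add: S_def)

lemma S_shift: "a \<in> S \<Longrightarrow> v \<in> L \<Longrightarrow> (v + a) \<bullet> (v + a) = 2 \<Longrightarrow> v + a \<in> S"
  using add[of v "a - \<mu>"] by (simp add: S_def add_diff_eq)

lemma S_norm: "a \<in> S \<Longrightarrow> a \<bullet> a = 2"
  by (simp add: S_def)

text \<open>The coset is its own negative, because \<open>a + a\<close> lies in
  \<open>L\<close>.\<close>

lemma S_minus:
  assumes "a \<in> S"
  shows "- a \<in> S"
  using S_shift[OF assms, of "- (a + a)"] minus[OF S_add[OF assms assms]] S_norm[OF assms]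
  by simp

lemma S_integral:
  assumes "a \<in> S" "v \<in> L"
  shows "a \<bullet> v \<in> \<int>"
proof -
  have "a \<bullet> v = (a - \<mu>) \<bullet> v + \<mu> \<bullet> v" by (simp add: inner_diff_left)
  then show ?thesis using integral[of "a - \<mu>" v] dual assms by (auto simp: S_def)
qed

lemma S_S_integral:
  assumes "a \<in> S" "b \<in> S"
  shows "a \<bullet> b \<in> \<int>"
proof -
  \<comment> \<open>The norm of a is known while that of \<open>\<mu>\<close> is not, so b is split
    into a and an element of \<open>L\<close>.\<close>
  have "a \<bullet> b = a \<bullet> (b - a) + 2" using S_norm[OF assms(1)] by (simp add: inner_diff_right)
  then show ?thesis using S_integral[OF assms(1) S_diff[OF assms(2,1)]] by simp
qed

text \<open>As a has norm 2, this is the reflection of b in the hyperplane orthogonal to a. For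
  inner product 1 or -1 it equals \<open>b - a\<close> or \<open>b + a\<close>, which lies in
  \<open>L\<close>.\<close>

lemma reflect_S:
  assumes "a \<in> S" "b \<in> S" "a \<bullet> b = 1 \<or> a \<bullet> b = -1"
  shows "b - (a \<bullet> b) *\<^sub>R a \<in> vectors_of_norm L 2"
  using assms S_diff[of b a] S_add[of b a] S_norm[of a] S_norm[of b]
  by (auto simp: vectors_of_norm_def inner_diff inner_add inner_commute)

text \<open>The reflected vector is a shift by \<open>v\<close> of \<open>- a\<close> or
  \<open>a\<close>, both of which belong to \<open>S\<close>.\<close>

lemma reflect_L:
  assumes "a \<in> S" "v \<in> vectors_of_norm L 2" "a \<bullet> v = 1 \<or> a \<bullet> v = -1"
  shows "v - (a \<bullet> v) *\<^sub>R a \<in> S"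
  using assms S_shift[of a v] S_shift[OF S_minus[of a], of v] S_norm[of a]
  by (auto simp: vectors_of_norm_def inner_diff inner_add inner_commute)

text \<open>Reflecting in a new vector of the frame sends the elements of S that are neither orthogonal
  nor parallel to it injectively into L, so passing to the orthogonal complement lowers the excess
  of S over the norm 2 vectors of L by at most two.\<close>

lemma orthogonal_frame_exists:
  assumes fin: "finite (vectors_of_norm L 2)"
    and large: "2 * n + card (vectors_of_norm L 2) \<le> card S"
    and "k \<le> n"
  shows "\<exists>\<beta>. norm2_orthogonal_basis k \<beta> \<and> \<beta> ` {1..k} \<subseteq> S \<and>
    2 * (n - k) + card {v \<in> vectors_of_norm L 2. \<forall>i\<in>{1..k}. \<beta> i \<bullet> v = 0}
      \<le> card {v \<in> S. \<forall>i\<in>{1..k}. \<beta> i \<bullet> v = 0}"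
  using \<open>k \<le> n\<close>
proof (induction k)
  case 0
  show ?case using large by (auto simp: norm2_orthogonal_basis_def)
next
  case (Suc k)
  then obtain \<beta> where \<beta>: "norm2_orthogonal_basis k \<beta>" "\<beta> ` {1..k} \<subseteq> S"
    and count: "2 * (n - k) + card {v \<in> vectors_of_norm L 2. \<forall>i\<in>{1..k}. \<beta> i \<bullet> v = 0}
      \<le> card {v \<in> S. \<forall>i\<in>{1..k}. \<beta> i \<bullet> v = 0}"
    by auto
  define T where "T = {v \<in> S. \<forall>i\<in>{1..k}. \<beta> i \<bullet> v = 0}"
  define R where "R = {v \<in> vectors_of_norm L 2. \<forall>i\<in>{1..k}. \<beta> i \<bullet> v = 0}"
  \<comment> \<open>The excess \<open>2 * (n - k)\<close> is still positive, so a next frame vector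
    exists. A positive \<open>card\<close> also gives finiteness of \<open>T\<close>.\<close>
  have "0 < card T" using count Suc.prems by (auto simp: T_def)
  then obtain a where a: "a \<in> T" and finT: "finite T" unfolding card_gt_0_iff by blast
  have finR: "finite R" using fin by (simp add: R_def)
  have aS: "a \<in> S" "a \<bullet> a = 2" using a S_norm by (auto simp: T_def)
  define \<gamma> where "\<gamma> = \<beta>(Suc k := a)"
  have T': "{v \<in> S. \<forall>i\<in>{1..Suc k}. \<gamma> i \<bullet> v = 0} = {v \<in> T. a \<bullet> v = 0}"
    and R': "{v \<in> vectors_of_norm L 2. \<forall>i\<in>{1..Suc k}. \<gamma> i \<bullet> v = 0} = {v \<in> R. a \<bullet> v = 0}"
    by (auto simp: T_def R_def \<gamma>_def atLeastAtMostSuc_conv)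
  define r where "r = (\<lambda>b. b - (a \<bullet> b) *\<^sub>R a)"
  have r_r: "r (r b) = b" for b
    using aS by (simp add: r_def inner_diff_right algebra_simps)
  \<comment> \<open>Apart from a and \<open>- a\<close>, an element of \<open>T\<close> not
    orthogonal to a has inner product 1 or -1 with it. Its reflection stays orthogonal to the
    earlier frame, since a and b both are.\<close>
  have "r b \<in> {v \<in> R. a \<bullet> v \<noteq> 0}" if b: "b \<in> T" "a \<bullet> b \<noteq> 0" "b \<notin> {a, - a}" for b
  proof -
    have bS: "b \<in> S" using b(1) by (simp add: T_def)
    have ab: "a \<bullet> b = 1 \<or> a \<bullet> b = -1"
      using norm2_inner_cases[OF aS(2) S_norm[OF bS] S_S_integral[OF aS(1) bS]] b(2,3) by fastforce
    have "r b \<in> vectors_of_norm L 2" unfolding r_def by (rule reflect_S[OF aS(1) bS ab])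
    moreover have "\<beta> i \<bullet> r b = 0" if "i \<in> {1..k}" for i
      using that a b(1) by (simp add: T_def r_def inner_diff_right)
    moreover have "a \<bullet> r b \<noteq> 0" using b(2) aS by (simp add: r_def inner_diff_right)
    ultimately show ?thesis by (simp add: R_def)
  qed
  then have "r ` ({v \<in> T. a \<bullet> v \<noteq> 0} - {a, - a}) \<subseteq> {v \<in> R. a \<bullet> v \<noteq> 0}" by blast
  moreover have "inj r" by (metis injI r_r)
  ultimately have "card ({v \<in> T. a \<bullet> v \<noteq> 0} - {a, - a}) \<le> card {v \<in> R. a \<bullet> v \<noteq> 0}"
    using finR by (intro card_inj_on_le[of r]) (auto intro: inj_on_subset)
  \<comment> \<open>The two vectors parallel to a are the only ones left out, whence the loss of at
    most 2.\<close>
  moreover have "card {v \<in> T. a \<bullet> v \<noteq> 0} \<le> card ({v \<in> T. a \<bullet> v \<noteq> 0} - {a, - a}) + 2"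
    using diff_card_le_card_Diff[of "{a, - a}" "{v \<in> T. a \<bullet> v \<noteq> 0}"] card_insert_le_m1[of 2 "{- a}" a]
    by simp
  moreover have "card T = card {v \<in> T. a \<bullet> v = 0} + card {v \<in> T. a \<bullet> v \<noteq> 0}"
    using finT by (subst card_Un_disjoint[symmetric]) (auto intro: arg_cong[where f = card])
  moreover have "card R = card {v \<in> R. a \<bullet> v = 0} + card {v \<in> R. a \<bullet> v \<noteq> 0}"
    using finR by (subst card_Un_disjoint[symmetric]) (auto intro: arg_cong[where f = card])
  moreover have "2 * (n - k) + card R \<le> card T" using count by (simp add: T_def R_def)
  ultimately have "2 * (n - Suc k) + card {v \<in> R. a \<bullet> v = 0} \<le> card {v \<in> T. a \<bullet> v = 0}"
    using Suc.prems by linarith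
  moreover have "norm2_orthogonal_basis (Suc k) \<gamma>"
    using \<beta>(1) a aS(2)
    by (auto simp: norm2_orthogonal_basis_def \<gamma>_def atLeastAtMostSuc_conv T_def inner_commute)
  moreover have "\<gamma> ` {1..Suc k} \<subseteq> S"
    using \<beta>(2) aS(1) by (auto simp: \<gamma>_def atLeastAtMostSuc_conv)
  ultimately show ?case unfolding T'[symmetric] R'[symmetric] by blast
qed

end

section \<open>Groups with an orthogonal frame in the coset\<close>

text \<open>The condition \<open>not_mem\<close> is confined to positive n: for n = 0 the group is
  zero and \<open>twice\<close> forces \<open>\<mu>\<close> to be 0.\<close>

locale framed_group = glued_group L \<mu> for L :: "'a::euclidean_space set" and \<mu> +
  fixes n :: nat and \<beta> :: "nat \<Rightarrow> 'a"
  assumes basis: "norm2_orthogonal_basis n \<beta>" and frame: "\<beta> ` {1..n} \<subseteq> S"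
    and spans: "L \<subseteq> span (\<beta> ` {1..n})" and not_mem: "n > 0 \<Longrightarrow> \<mu> \<notin> L"
begin

lemma in_S: "i \<in> {1..n} \<Longrightarrow> \<beta> i \<in> S"
  using frame by auto

lemma frame_not_mem: "i \<in> {1..n} \<Longrightarrow> \<beta> i \<notin> L"
  using diff[of "\<beta> i" "\<beta> i - \<mu>"] in_S[of i] not_mem by (auto simp: S_def)

lemma coord:
  assumes "v \<in> L" "i \<in> {1..n}"
  shows "v \<bullet> \<beta> i \<in> \<int>"
  using S_integral[OF in_S[OF assms(2)] assms(1)] by (simp add: inner_commute)

lemma frame_sum_even: "even (\<Sum>i\<in>I. m i) \<Longrightarrow> I \<subseteq> {1..n} \<Longrightarrow> (\<Sum>i\<in>I. of_int (m i) *\<^sub>R \<beta> i) \<in> L"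
  by (rule even_combination) (auto intro: S_add in_S[unfolded One_nat_def])

text \<open>The coefficients of \<open>v\<close> are then integers \<open>m i\<close>, and the claim
  is that their sum is even. With an odd sum, subtracting an even combination would leave a single
  frame vector in \<open>L\<close>, against \<open>frame_not_mem\<close>.\<close>

lemma even_coords:
  assumes v: "v \<in> L" and half: "\<And>i. i \<in> {1..n} \<Longrightarrow> v \<bullet> \<beta> i / 2 \<in> \<int>"
  shows "v \<bullet> (\<Sum>i\<in>{1..n}. \<beta> i) / 4 \<in> \<int>"
proof -
  define m where "m = (\<lambda>i. \<lfloor>v \<bullet> \<beta> i / 2\<rfloor>)"
  have m: "v \<bullet> \<beta> i / 2 = of_int (m i)" if "i \<in> {1..n}" for i
    using half[OF that] unfolding m_def by (rule of_int_floor[symmetric])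
  have v_eq: "v = (\<Sum>i\<in>{1..n}. of_int (m i) *\<^sub>R \<beta> i)"
    using norm2_basis_expand[OF basis subsetD[OF spans v]] m by (simp only: cong: sum.cong)
  have "even (\<Sum>i\<in>{1..n}. m i)"
  proof (rule ccontr)
    assume odd: "odd (\<Sum>i\<in>{1..n}. m i)"
    then have n: "1 \<in> {1..n}" by (cases n) auto
    define m' where "m' = m(1 := m 1 - 1)"
    have m'_eq: "m' i = m i - (if i = 1 then 1 else 0)" for i by (simp add: m'_def)
    have "even (\<Sum>i\<in>{1..n}. m' i)" using odd n by (simp add: m'_eq sum_subtractf)
    then have "(\<Sum>i\<in>{1..n}. of_int (m' i) *\<^sub>R \<beta> i) \<in> L" by (rule frame_sum_even) simp
    also have "(\<Sum>i\<in>{1..n}. of_int (m' i) *\<^sub>R \<beta> i) = v - (\<Sum>i\<in>{1..n}. if i = 1 then \<beta> i else 0)"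
      unfolding v_eq sum_subtractf[symmetric] by (intro sum.cong) (auto simp: m'_eq algebra_simps)
    also have "(\<Sum>i\<in>{1..n}. if i = 1 then \<beta> i else 0) = \<beta> 1" using n by simp
    finally have "\<beta> 1 \<in> L" using diff[OF v] by fastforce
    then show False using frame_not_mem[OF n] by simp
  qed
  then obtain k where k: "(\<Sum>i\<in>{1..n}. m i) = 2 * k" by auto
  have "v \<bullet> (\<Sum>i\<in>{1..n}. \<beta> i) = (\<Sum>i\<in>{1..n}. 2 * of_int (m i))"
    unfolding inner_sum_right using m by (intro sum.cong) auto
  also have "\<dots> = 2 * of_int (\<Sum>i\<in>{1..n}. m i)" by (simp add: sum_distrib_left)
  finally show ?thesis unfolding k by simp
qed

text \<open>The norm of \<open>v\<close> is half the sum of the squared coordinates, so evenness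
  makes that sum divisible by 4. Mod 4 it counts the odd coordinates, and mod 2 it agrees with the
  coordinate sum.\<close>

lemma odd_support:
  assumes v: "v \<in> L"
  shows "4 dvd card {i \<in> {1..n}. v \<bullet> \<beta> i / 2 \<notin> \<int>}"
    and "v \<bullet> (\<Sum>i\<in>{1..n}. \<beta> i) / 2 \<in> \<int>"
proof -
  define x where "x = (\<lambda>i. \<lfloor>v \<bullet> \<beta> i\<rfloor>)"
  have x: "v \<bullet> \<beta> i = of_int (x i)" if "i \<in> {1..n}" for i
    using coord[OF v that] by (simp add: x_def)
  obtain k :: int where k: "v \<bullet> v = 2 * of_int k" using even[OF v] by auto
  have "v \<bullet> v = (\<Sum>i\<in>{1..n}. (v \<bullet> \<beta> i) * (v \<bullet> \<beta> i)) / 2"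
    using norm2_basis_inner[OF basis] v spans by blast
  also have "(\<Sum>i\<in>{1..n}. (v \<bullet> \<beta> i) * (v \<bullet> \<beta> i)) = of_int (\<Sum>i\<in>{1..n}. (x i)\<^sup>2)"
    unfolding of_int_sum using x by (intro sum.cong) (auto simp: power2_eq_square)
  finally have "of_int (\<Sum>i\<in>{1..n}. (x i)\<^sup>2) = (of_int (4 * k) :: real)" using k by simp
  then have sq: "(\<Sum>i\<in>{1..n}. (x i)\<^sup>2) = 4 * k" by (simp only: of_int_eq_iff)
  have "{i \<in> {1..n}. v \<bullet> \<beta> i / 2 \<notin> \<int>} = {i \<in> {1..n}. odd (x i)}"
    using x half_of_int_in_Ints_iff by auto
  moreover have "4 dvd int (card {i \<in> {1..n}. odd (x i)})"
    using sum_squares_mod_4[of "{1..n}" x] sq by (simp add: dvd_diff_right_iff)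
  ultimately show "4 dvd card {i \<in> {1..n}. v \<bullet> \<beta> i / 2 \<notin> \<int>}"
    by (metis int_dvd_int_iff of_nat_numeral)
  have "even (\<Sum>i\<in>{1..n}. x i) \<longleftrightarrow> even (\<Sum>i\<in>{1..n}. (x i)\<^sup>2)"
    by (simp add: even_sum_iff)
  then have "even (\<Sum>i\<in>{1..n}. x i)" using sq by simp
  moreover have "v \<bullet> (\<Sum>i\<in>{1..n}. \<beta> i) = of_int (\<Sum>i\<in>{1..n}. x i)"
    unfolding inner_sum_right of_int_sum using x by (intro sum.cong) auto
  ultimately show "v \<bullet> (\<Sum>i\<in>{1..n}. \<beta> i) / 2 \<in> \<int>"
    by (simp only: half_of_int_in_Ints_iff)
qed

lemma flip_frame:
  assumes "j \<in> {1..n}"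
  shows "framed_group L \<mu> n (\<beta>(j := - \<beta> j))"
proof unfold_locales
  show "norm2_orthogonal_basis n (\<beta>(j := - \<beta> j))"
    using basis by (auto simp: norm2_orthogonal_basis_def)
  show "(\<beta>(j := - \<beta> j)) ` {1..n} \<subseteq> S" using in_S S_minus by auto
  have "\<beta> i \<in> span ((\<beta>(j := - \<beta> j)) ` {1..n})" if "i \<in> {1..n}" for i
  proof (cases "i = j")
    case True
    have "- \<beta> j \<in> span ((\<beta>(j := - \<beta> j)) ` {1..n})" using assms by (intro span_base) force
    then show ?thesis using True span_neg by fastforce
  next
    case False
    then show ?thesis using that by (intro span_base) force
  qed
  then have "span (\<beta> ` {1..n}) \<subseteq> span ((\<beta>(j := - \<beta> j)) ` {1..n})"
    by (intro span_minimal) auto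
  then show "L \<subseteq> span ((\<beta>(j := - \<beta> j)) ` {1..n})" using spans by blast
qed (rule not_mem)

end

section \<open>Choice of signs for the frame\<close>

context framed_group
begin

text \<open>The sign of one frame vector is chosen at a time. Flipping a coordinate that is even on the
  subgroup treated so far does not change the coordinate sum mod 4 there, while it changes the sum
  by 2 mod 4 on a vector where that coordinate is odd.\<close>

lemma signs_exist_aux:
  assumes "k \<le> n"
  shows "\<exists>\<gamma>. framed_group L \<mu> n \<gamma> \<and> (\<forall>v\<in>L. (\<forall>i\<in>{k<..n}. v \<bullet> \<gamma> i / 2 \<in> \<int>) \<longrightarrow>
    v \<bullet> (\<Sum>i\<in>{1..n}. \<gamma> i) / 4 \<in> \<int>)"
  using assms
proof (induction k)
  case 0
  \<comment> \<open>All coordinates are even here, which is the situation of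
    \<open>even_coords\<close>.\<close>
  have "{0<..n} = {1..n}" by auto
  then show ?case using even_coords framed_group_axioms by auto
next
  case (Suc k)
  then obtain \<gamma> where \<gamma>: "framed_group L \<mu> n \<gamma>"
    and sum4: "\<And>v. v \<in> L \<Longrightarrow> \<forall>i\<in>{k<..n}. v \<bullet> \<gamma> i / 2 \<in> \<int> \<Longrightarrow> v \<bullet> (\<Sum>i\<in>{1..n}. \<gamma> i) / 4 \<in> \<int>"
    by auto
  interpret G: framed_group L \<mu> n \<gamma> by (rule \<gamma>)
  have split: "{k<..n} = insert (Suc k) {Suc k<..n}" using Suc.prems by auto
  have k: "Suc k \<in> {1..n}" using Suc.prems by simp
  \<comment> \<open>A vector u of the larger subgroup that is odd at \<open>Suc k\<close> decides
    the sign; if there is none, the subgroup does not grow.\<close>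
  show ?case
  proof (cases "\<exists>u\<in>L. (\<forall>i\<in>{Suc k<..n}. u \<bullet> \<gamma> i / 2 \<in> \<int>) \<and> u \<bullet> \<gamma> (Suc k) / 2 \<notin> \<int>")
    case False
    have "v \<bullet> (\<Sum>i\<in>{1..n}. \<gamma> i) / 4 \<in> \<int>"
      if "v \<in> L" "\<forall>i\<in>{Suc k<..n}. v \<bullet> \<gamma> i / 2 \<in> \<int>" for v
      using that False by (intro sum4) (auto simp: split)
    then show ?thesis using \<gamma> by blast
  next
    case True
    then obtain u where u: "u \<in> L" "\<forall>i\<in>{Suc k<..n}. u \<bullet> \<gamma> i / 2 \<in> \<int>" "u \<bullet> \<gamma> (Suc k) / 2 \<notin> \<int>"
      by auto
    have "\<exists>\<delta>. framed_group L \<mu> n \<delta> \<and> (\<forall>i. \<delta> i = \<gamma> i \<or> \<delta> i = - \<gamma> i) \<and> u \<bullet> (\<Sum>i\<in>{1..n}. \<delta> i) / 4 \<in> \<int> \<and>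
      (\<forall>v\<in>L. (\<forall>i\<in>{k<..n}. v \<bullet> \<gamma> i / 2 \<in> \<int>) \<longrightarrow> v \<bullet> (\<Sum>i\<in>{1..n}. \<delta> i) / 4 \<in> \<int>)"
    proof (cases "u \<bullet> (\<Sum>i\<in>{1..n}. \<gamma> i) / 4 \<in> \<int>")
      case True
      then show ?thesis using \<gamma> sum4 by blast
    next
      case False
      define \<delta> where "\<delta> = \<gamma>(Suc k := - \<gamma> (Suc k))"
      have "(\<Sum>i\<in>{1..n}. \<delta> i) = (\<Sum>i\<in>{1..n}. \<gamma> i - (if i = Suc k then 2 *\<^sub>R \<gamma> i else 0))"
        by (intro sum.cong) (auto simp: \<delta>_def scaleR_2)
      then have sum_\<delta>: "(\<Sum>i\<in>{1..n}. \<delta> i) = (\<Sum>i\<in>{1..n}. \<gamma> i) - 2 *\<^sub>R \<gamma> (Suc k)"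
        using k by (simp add: sum_subtractf)
      have *: "v \<bullet> (\<Sum>i\<in>{1..n}. \<delta> i) / 4 = (v \<bullet> (\<Sum>i\<in>{1..n}. \<gamma> i) / 2 - v \<bullet> \<gamma> (Suc k)) / 2" for v
        unfolding sum_\<delta> by (simp add: inner_diff_right field_simps)
      \<comment> \<open>Half the old sum is an odd integer, as the sum is not divisible by 4. The
        flipped coordinate of u is odd too, so the difference is even.\<close>
      have "u \<bullet> (\<Sum>i\<in>{1..n}. \<delta> i) / 4 \<in> \<int>"
        unfolding * using G.odd_support(2)[OF u(1)] G.coord[OF u(1) k] u(3) False
        by (intro half_diff_in_Ints) auto
      moreover have "v \<bullet> (\<Sum>i\<in>{1..n}. \<delta> i) / 4 \<in> \<int>"
        if "v \<in> L" "\<forall>i\<in>{k<..n}. v \<bullet> \<gamma> i / 2 \<in> \<int>" for v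
      proof -
        have "v \<bullet> (\<Sum>i\<in>{1..n}. \<gamma> i) / 4 - v \<bullet> \<gamma> (Suc k) / 2 \<in> \<int>"
          using sum4[OF that] that(2) split by (intro Ints_diff) auto
        then show ?thesis unfolding * by (simp add: diff_divide_distrib)
      qed
      moreover have "framed_group L \<mu> n \<delta>" unfolding \<delta>_def by (rule G.flip_frame[OF k])
      moreover have "\<forall>i. \<delta> i = \<gamma> i \<or> \<delta> i = - \<gamma> i" by (simp add: \<delta>_def)
      ultimately show ?thesis by blast
    qed
    then obtain \<delta> where \<delta>: "framed_group L \<mu> n \<delta>" "\<And>i. \<delta> i = \<gamma> i \<or> \<delta> i = - \<gamma> i"
      and u4: "u \<bullet> (\<Sum>i\<in>{1..n}. \<delta> i) / 4 \<in> \<int>"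
      and v4: "\<And>v. v \<in> L \<Longrightarrow> \<forall>i\<in>{k<..n}. v \<bullet> \<gamma> i / 2 \<in> \<int> \<Longrightarrow> v \<bullet> (\<Sum>i\<in>{1..n}. \<delta> i) / 4 \<in> \<int>"
      by blast
    have half: "v \<bullet> \<delta> i / 2 \<in> \<int> \<longleftrightarrow> v \<bullet> \<gamma> i / 2 \<in> \<int>" for v i
    proof -
      have "v \<bullet> \<delta> i / 2 = v \<bullet> \<gamma> i / 2 \<or> v \<bullet> \<delta> i / 2 = - (v \<bullet> \<gamma> i / 2)" using \<delta>(2)[of i] by auto
      then show ?thesis by (metis minus_in_Ints_iff)
    qed
    have "v \<bullet> (\<Sum>i\<in>{1..n}. \<delta> i) / 4 \<in> \<int>"
      if v: "v \<in> L" "\<forall>i\<in>{Suc k<..n}. v \<bullet> \<gamma> i / 2 \<in> \<int>" for v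
    proof (cases "v \<bullet> \<gamma> (Suc k) / 2 \<in> \<int>")
      case True
      then show ?thesis using v4[OF v(1)] v(2) split by simp
    next
      case False
      \<comment> \<open>Both vectors are odd at \<open>Suc k\<close>, so their difference lies in
        the subgroup already treated, and the claim for u carries over to \<open>v\<close>.\<close>
      have "(v - u) \<bullet> \<gamma> i / 2 \<in> \<int>" if "i \<in> {k<..n}" for i
      proof (cases "i = Suc k")
        case True
        then show ?thesis
          using half_diff_in_Ints[OF G.coord[OF v(1) k] G.coord[OF u(1) k] False u(3)]
          by (simp add: inner_diff_left)
      next
        case False
        then have "v \<bullet> \<gamma> i / 2 \<in> \<int>" "u \<bullet> \<gamma> i / 2 \<in> \<int>" using that split v(2) u(2) by auto
        then have "v \<bullet> \<gamma> i / 2 - u \<bullet> \<gamma> i / 2 \<in> \<int>" by (rule Ints_diff)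
        then show ?thesis by (simp add: inner_diff_left diff_divide_distrib)
      qed
      then have "(v - u) \<bullet> (\<Sum>i\<in>{1..n}. \<delta> i) / 4 + u \<bullet> (\<Sum>i\<in>{1..n}. \<delta> i) / 4 \<in> \<int>"
        using v4[OF diff[OF v(1) u(1)]] u4 by (intro Ints_add) auto
      then show ?thesis by (simp add: inner_diff_left diff_divide_distrib)
    qed
    then show ?thesis using \<delta>(1) half by blast
  qed
qed

lemma signs_exist:
  "\<exists>\<gamma>. framed_group L \<mu> n \<gamma> \<and> (\<forall>v\<in>L. v \<bullet> (\<Sum>i\<in>{1..n}. \<gamma> i) / 4 \<in> \<int>)"
  using signs_exist_aux[of n] by simp

section \<open>The binary code of odd coordinates\<close>

text \<open>The number \<open>v \<bullet> \<beta> i / 2\<close> is the coefficient of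
  \<open>\<beta> i\<close> in \<open>v\<close>, so the codeword of \<open>v\<close> marks its
  properly half-integral coefficients.\<close>

definition odd_coords :: "'a \<Rightarrow> nat set" where
  "odd_coords v = {i \<in> {1..n}. v \<bullet> \<beta> i / 2 \<notin> \<int>}"

lemma odd_coords_diff:
  assumes "u \<in> L" "v \<in> L"
  shows "odd_coords (u - v) = (odd_coords u - odd_coords v) \<union> (odd_coords v - odd_coords u)"
proof -
  have "(u - v) \<bullet> \<beta> i / 2 \<notin> \<int> \<longleftrightarrow> (u \<bullet> \<beta> i / 2 \<notin> \<int>) \<noteq> (v \<bullet> \<beta> i / 2 \<notin> \<int>)" if "i \<in> {1..n}" for i
  proof -
    have *: "(u - v) \<bullet> \<beta> i / 2 = u \<bullet> \<beta> i / 2 - v \<bullet> \<beta> i / 2"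
      by (simp add: inner_diff_left diff_divide_distrib)
    consider "u \<bullet> \<beta> i / 2 \<in> \<int>" "v \<bullet> \<beta> i / 2 \<in> \<int>" | "u \<bullet> \<beta> i / 2 \<notin> \<int>" "v \<bullet> \<beta> i / 2 \<notin> \<int>"
      | "(u \<bullet> \<beta> i / 2 \<in> \<int>) \<noteq> (v \<bullet> \<beta> i / 2 \<in> \<int>)" by blast
    then show ?thesis
    proof cases
      case 2
      then have "(u - v) \<bullet> \<beta> i / 2 \<in> \<int>"
        using half_diff_in_Ints[of "u \<bullet> \<beta> i" "v \<bullet> \<beta> i"] coord assms that by (simp add: inner_diff_left)
      then show ?thesis using 2 by simp
    next
      case 3
      moreover have "(u - v) \<bullet> \<beta> i / 2 \<in> \<int> \<Longrightarrow> u \<bullet> \<beta> i / 2 \<in> \<int> \<longleftrightarrow> v \<bullet> \<beta> i / 2 \<in> \<int>"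
        unfolding * by (rule Ints_diff_imp_iff)
      ultimately show ?thesis by blast
    qed (simp add: *)
  qed
  then show ?thesis by (auto simp: odd_coords_def)
qed

lemma linear_code_odd_coords: "linear_code n (odd_coords ` L)"
  unfolding linear_code_def
proof (intro conjI ballI)
  show "odd_coords ` L \<subseteq> Pow {1..n}" by (auto simp: odd_coords_def)
  have "odd_coords 0 = {}" by (simp add: odd_coords_def)
  then show "{} \<in> odd_coords ` L" using zero by force
  fix c d assume "c \<in> odd_coords ` L" "d \<in> odd_coords ` L"
  then show "(c - d) \<union> (d - c) \<in> odd_coords ` L"
    using odd_coords_diff diff by (force simp flip: odd_coords_diff)
qed

text \<open>Removing half the sum over the codeword makes all coefficients integral. Half of their
  sum is a quarter of the coordinate sum minus a quarter of the weight of the codeword; both are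
  integers, by \<open>sum4\<close> and \<open>odd_support\<close>.\<close>

lemma codeword_diff:
  assumes sum4: "\<And>v. v \<in> L \<Longrightarrow> v \<bullet> (\<Sum>i\<in>{1..n}. \<beta> i) / 4 \<in> \<int>" and v: "v \<in> L"
  obtains m where "even (\<Sum>i\<in>{1..n}. m i)"
    "v - (1/2) *\<^sub>R (\<Sum>i\<in>odd_coords v. \<beta> i) = (\<Sum>i\<in>{1..n}. of_int (m i) *\<^sub>R \<beta> i)"
proof -
  define c where "c = odd_coords v"
  have c: "c \<subseteq> {1..n}" by (auto simp: c_def odd_coords_def)
  then have "finite c" by (rule finite_subset) simp
  define h where "h = (\<lambda>i. v \<bullet> \<beta> i / 2 - (if i \<in> c then 1/2 else 0))"
  have "h i \<in> \<int>" if "i \<in> {1..n}" for i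
  proof (cases "i \<in> c")
    case True
    then show ?thesis
      using half_diff_in_Ints[of "v \<bullet> \<beta> i" 1] coord[OF v that] half_of_int_in_Ints_iff[of 1]
      by (simp add: h_def c_def odd_coords_def diff_divide_distrib)
  next
    case False
    then show ?thesis using that by (simp add: h_def c_def odd_coords_def)
  qed
  then have hm: "h i = of_int \<lfloor>h i\<rfloor>" if "i \<in> {1..n}" for i using that by simp
  have "(1/2) *\<^sub>R (\<Sum>i\<in>c. \<beta> i) = (\<Sum>i\<in>{1..n} \<inter> c. (1/2) *\<^sub>R \<beta> i)"
    using c by (simp add: scaleR_sum_right Int_absorb1)
  also have "\<dots> = (\<Sum>i\<in>{1..n}. (if i \<in> c then 1/2 else 0) *\<^sub>R \<beta> i)"
    by (subst sum.inter_restrict) (auto intro: sum.cong)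
  finally have "v - (1/2) *\<^sub>R (\<Sum>i\<in>c. \<beta> i) =
      (\<Sum>i\<in>{1..n}. (v \<bullet> \<beta> i / 2) *\<^sub>R \<beta> i) - (\<Sum>i\<in>{1..n}. (if i \<in> c then 1/2 else 0) *\<^sub>R \<beta> i)"
    using norm2_basis_expand[OF basis subsetD[OF spans v]] by simp
  also have "\<dots> = (\<Sum>i\<in>{1..n}. h i *\<^sub>R \<beta> i)"
    by (simp only: h_def scaleR_diff_left sum_subtractf)
  also have "\<dots> = (\<Sum>i\<in>{1..n}. of_int \<lfloor>h i\<rfloor> *\<^sub>R \<beta> i)"
    using hm by (intro sum.cong) auto
  finally have eq: "v - (1/2) *\<^sub>R (\<Sum>i\<in>c. \<beta> i) = (\<Sum>i\<in>{1..n}. of_int \<lfloor>h i\<rfloor> *\<^sub>R \<beta> i)" .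
  obtain q where q: "card c = 4 * q" using odd_support(1)[OF v] unfolding c_def odd_coords_def by (rule dvdE)
  have "of_int (\<Sum>i\<in>{1..n}. \<lfloor>h i\<rfloor>) = (\<Sum>i\<in>{1..n}. h i)"
    unfolding of_int_sum using hm by (intro sum.cong) auto
  also have "\<dots> = (\<Sum>i\<in>{1..n}. v \<bullet> \<beta> i) / 2 - (\<Sum>i\<in>{1..n}. if i \<in> c then 1/2 else 0)"
    by (simp only: h_def sum_subtractf sum_divide_distrib)
  also have "(\<Sum>i\<in>{1..n}. if i \<in> c then 1/2 else 0 :: real) = card c / 2"
    using c by (simp add: sum.If_cases Int_absorb1)
  finally have half: "of_int (\<Sum>i\<in>{1..n}. \<lfloor>h i\<rfloor>) / 2 = v \<bullet> (\<Sum>i\<in>{1..n}. \<beta> i) / 4 - real q"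
    by (simp add: inner_sum_right q)
  have "of_int (\<Sum>i\<in>{1..n}. \<lfloor>h i\<rfloor>) / 2 \<in> (\<int> :: real set)"
    unfolding half using sum4[OF v] by (rule Ints_diff) simp
  then have "even (\<Sum>i\<in>{1..n}. \<lfloor>h i\<rfloor>)" by (simp only: half_of_int_in_Ints_iff)
  then show thesis using eq that unfolding c_def by blast
qed

text \<open>By \<open>codeword_diff\<close>, \<open>v\<close> and its half codeword sum differ by an
  even combination of frame vectors. Such combinations lie both in \<open>L\<close> and in the
  generated group, so each inclusion follows.\<close>

lemma eq_L_B:
  assumes sum4: "\<And>v. v \<in> L \<Longrightarrow> v \<bullet> (\<Sum>i\<in>{1..n}. \<beta> i) / 4 \<in> \<int>"
  shows "L = L_B n \<beta> (odd_coords ` L)"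
proof
  let ?X = "{(1/2) *\<^sub>R (\<Sum>i\<in>c. \<beta> i) | c. c \<in> odd_coords ` L} \<union>
    {\<beta> i + \<beta> j | i j. i \<in> {1..n} \<and> j \<in> {1..n}}"
  interpret D: additive_subgroup "group_closure ?X" by (rule additive_subgroup_group_closure)
  show "L \<subseteq> L_B n \<beta> (odd_coords ` L)"
    unfolding L_B_def
  proof
    fix v assume v: "v \<in> L"
    obtain m where m: "even (\<Sum>i\<in>{1..n}. m i)"
      "v - (1/2) *\<^sub>R (\<Sum>i\<in>odd_coords v. \<beta> i) = (\<Sum>i\<in>{1..n}. of_int (m i) *\<^sub>R \<beta> i)"
      using codeword_diff[OF sum4 v] by blast
    have "\<beta> i + \<beta> j \<in> group_closure ?X" if "i \<in> {1..n}" "j \<in> {1..n}" for i j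
      using that by (intro group_closure.base) blast
    then have "v - (1/2) *\<^sub>R (\<Sum>i\<in>odd_coords v. \<beta> i) \<in> group_closure ?X"
      unfolding m(2) using m(1) by (rule D.even_combination)
    moreover have "(1/2) *\<^sub>R (\<Sum>i\<in>odd_coords v. \<beta> i) \<in> group_closure ?X"
      using v by (intro group_closure.base) blast
    ultimately show "v \<in> group_closure ?X" using D.add by fastforce
  qed
  have "?X \<subseteq> L"
  proof -
    have "(1/2) *\<^sub>R (\<Sum>i\<in>odd_coords v. \<beta> i) \<in> L" if v: "v \<in> L" for v
    proof -
      obtain m where m: "even (\<Sum>i\<in>{1..n}. m i)"
        "v - (1/2) *\<^sub>R (\<Sum>i\<in>odd_coords v. \<beta> i) = (\<Sum>i\<in>{1..n}. of_int (m i) *\<^sub>R \<beta> i)"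
        using codeword_diff[OF sum4 v] by blast
      then have "v - (1/2) *\<^sub>R (\<Sum>i\<in>odd_coords v. \<beta> i) \<in> L"
        using frame_sum_even[OF m(1) order.refl] by simp
      from diff[OF v this] show ?thesis by simp
    qed
    moreover have "\<beta> i + \<beta> j \<in> L" if "i \<in> {1..n}" "j \<in> {1..n}" for i j
      using S_add in_S that by blast
    ultimately show ?thesis by blast
  qed
  then show "L_B n \<beta> (odd_coords ` L) \<subseteq> L"
    unfolding L_B_def by (rule group_closure_subset)
qed

end

section \<open>Transport of Construction B between orthogonal bases\<close>

lemma group_closure_image:
  fixes f :: "'a::ab_group_add \<Rightarrow> 'b::ab_group_add"
  assumes "\<And>x y. f (x - y) = f x - f y"
  shows "group_closure (f ` X) = f ` group_closure X"
proof
  \<comment> \<open>The base case of \<open>group_closure\<close> includes 0 besides the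
    generators.\<close>
  have f0: "f 0 = 0" using assms[of 0 0] by simp
  show "group_closure (f ` X) \<subseteq> f ` group_closure X"
  proof
    fix y assume "y \<in> group_closure (f ` X)"
    then show "y \<in> f ` group_closure X"
    proof induction
      case (base s)
      then show ?case using f0 by (auto intro: group_closure.base intro!: image_eqI[of 0])
    next
      case (diff s t)
      then show ?case by (auto simp flip: assms intro: group_closure.diff)
    qed
  qed
  have "f x \<in> group_closure (f ` X)" if "x \<in> group_closure X" for x
    using that
  proof induction
    case (base s)
    then show ?case using f0 by (auto intro: group_closure.base)
  next
    case (diff s t)
    then show ?case by (simp add: assms group_closure.diff)
  qed
  then show "f ` group_closure X \<subseteq> group_closure (f ` X)" by auto
qed

lemma L_B_subset_span:
  assumes "C \<subseteq> Pow {1..n}"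
  shows "L_B n \<beta> C \<subseteq> span (\<beta> ` {1..n})"
proof -
  interpret additive_subgroup "span (\<beta> ` {1..n})"
    by unfold_locales (auto intro: span_diff span_zero)
  show ?thesis
    unfolding L_B_def using assms
    by (intro group_closure_subset) (auto intro!: span_scale span_sum span_add intro: span_base)
qed

lemma pair_sums_eq_image:
  "{g i + g j | i j. i \<in> A \<and> j \<in> A} = (\<lambda>(i, j). g i + g j) ` (A \<times> A)"
  by auto

text \<open>The frame found in the coset and the given basis \<open>\<alpha>\<close> may live in
  different spaces. The linear map taking one to the other preserves inner products on the span and
  carries generators to generators.\<close>

lemma isometric_L_B:
  fixes \<beta> :: "nat \<Rightarrow> 'a::euclidean_space" and \<alpha> :: "nat \<Rightarrow> 'b::euclidean_space"
  assumes \<beta>: "norm2_orthogonal_basis n \<beta>" and \<alpha>: "norm2_orthogonal_basis n \<alpha>"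
    and C: "C \<subseteq> Pow {1..n}"
  shows "isometric_lattices (L_B n \<beta> C) (L_B n \<alpha> C)"
proof -
  define f where "f = (\<lambda>v. \<Sum>i\<in>{1..n}. (v \<bullet> \<beta> i / 2) *\<^sub>R \<alpha> i)"
  have lin: "linear f"
    unfolding f_def by (intro linear_compose_sum ballI linearI)
      (simp_all add: inner_add_left add_divide_distrib scaleR_add_left)
  have f_\<beta>: "f (\<beta> j) = \<alpha> j" if "j \<in> {1..n}" for j
  proof -
    have "f (\<beta> j) = (\<Sum>i\<in>{1..n}. if i = j then \<alpha> i else 0)"
      unfolding f_def using \<beta> that
      by (intro sum.cong) (auto simp: norm2_orthogonal_basis_def)
    then show ?thesis using that by simp
  qed
  have f_inner: "f v \<bullet> \<alpha> j = v \<bullet> \<beta> j" if "j \<in> {1..n}" for v j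
    unfolding f_def using norm2_basis_inner_sum[OF \<alpha> that order.refl] that by simp
  have f_span: "f v \<in> span (\<alpha> ` {1..n})" for v
    unfolding f_def by (intro span_sum span_scale span_base) auto
  have iso: "f u \<bullet> f v = u \<bullet> v" if "v \<in> span (\<beta> ` {1..n})" for u v
    unfolding norm2_basis_inner[OF \<alpha> f_span] norm2_basis_inner[OF \<beta> that]
    by (simp only: f_inner cong: sum.cong)
  have sub: "L_B n \<beta> C \<subseteq> span (\<beta> ` {1..n})" using C by (rule L_B_subset_span)
  have "inj_on f (L_B n \<beta> C)"
  proof
    fix u v assume uv: "u \<in> L_B n \<beta> C" "v \<in> L_B n \<beta> C" "f u = f v"
    then have "u - v \<in> span (\<beta> ` {1..n})" using sub by (auto intro: span_diff)
    then have "(u - v) \<bullet> (u - v) = f (u - v) \<bullet> f (u - v)" using iso by simp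
    also have "f (u - v) = 0" using uv(3) lin by (simp add: linear_diff)
    finally show "u = v" by simp
  qed
  moreover have "f ` L_B n \<beta> C = L_B n \<alpha> C"
  proof -
    have "f ((1/2) *\<^sub>R (\<Sum>i\<in>c. \<beta> i)) = (1/2) *\<^sub>R (\<Sum>i\<in>c. \<alpha> i)" if "c \<in> C" for c
    proof -
      have sub: "c \<subseteq> {1..n}" using that C by blast
      have "(\<Sum>i\<in>c. f (\<beta> i)) = (\<Sum>i\<in>c. \<alpha> i)" by (intro sum.cong refl f_\<beta> subsetD[OF sub])
      then show ?thesis by (simp add: linear_scale[OF lin] linear_sum[OF lin])
    qed
    then have "f ` {(1/2) *\<^sub>R (\<Sum>i\<in>c. \<beta> i) | c. c \<in> C} = {(1/2) *\<^sub>R (\<Sum>i\<in>c. \<alpha> i) | c. c \<in> C}"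
      by (auto simp: Setcompr_eq_image image_image intro!: image_cong)
    moreover have "f ` {\<beta> i + \<beta> j | i j. i \<in> {1..n} \<and> j \<in> {1..n}} =
        {\<alpha> i + \<alpha> j | i j. i \<in> {1..n} \<and> j \<in> {1..n}}"
    proof -
      have "f (\<beta> i + \<beta> j) = \<alpha> i + \<alpha> j" if "i \<in> {1..n}" "j \<in> {1..n}" for i j
        using f_\<beta>[OF that(1)] f_\<beta>[OF that(2)] by (simp add: linear_add[OF lin])
      then have "f ` (\<lambda>(i, j). \<beta> i + \<beta> j) ` ({1..n} \<times> {1..n}) = (\<lambda>(i, j). \<alpha> i + \<alpha> j) ` ({1..n} \<times> {1..n})"
        unfolding image_image by (intro image_cong) auto
      then show ?thesis by (simp only: pair_sums_eq_image)
    qed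
    ultimately show ?thesis
      unfolding L_B_def by (subst group_closure_image[symmetric]) (simp_all add: linear_diff[OF lin] image_Un)
  qed
  ultimately show ?thesis
    unfolding isometric_lattices_def bij_betw_def using iso sub linear_add[OF lin] by blast
qed

section \<open>Counting the norm 2 vectors of a framed coset\<close>

lemma (in glued_group) S_eq_coset: "S = vectors_of_norm (coset_of \<mu> L) 2"
  by (auto simp: S_def vectors_of_norm_def coset_of_def image_iff algebra_simps intro!: bexI[of _ "_ - \<mu>"])

context framed_group
begin

lemma finite_S: "finite S"
proof (rule finite_norm2_integral)
  fix x assume x: "x \<in> S"
  show "x \<in> span (\<beta> ` {1..n}) \<and> x \<bullet> x = 2 \<and> (\<forall>b\<in>\<beta> ` {1..n}. x \<bullet> b \<in> \<int>)"
  proof (intro conjI ballI)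
    have "x + x \<in> span (\<beta> ` {1..n})" using S_add[OF x x] spans by blast
    then have "(1/2) *\<^sub>R (x + x) \<in> span (\<beta> ` {1..n})" by (rule span_scale)
    then show "x \<in> span (\<beta> ` {1..n})" by (simp add: scaleR_2[symmetric])
  qed (use x S_norm S_S_integral frame in auto)
qed simp

text \<open>Inner product 2 or -2 would make \<open>v\<close> equal to \<open>\<beta> i\<close> or
  its negative, which are not in \<open>L\<close>.\<close>

lemma L_frame_inner:
  assumes "v \<in> vectors_of_norm L 2" "i \<in> {1..n}"
  shows "v \<bullet> \<beta> i = 0 \<or> v \<bullet> \<beta> i = 1 \<or> v \<bullet> \<beta> i = -1"
proof -
  have v: "v \<in> L" "v \<bullet> v = 2" using assms(1) by (auto simp: vectors_of_norm_def)
  have "v \<noteq> \<beta> i" "v \<noteq> - \<beta> i" using frame_not_mem[OF assms(2)] v(1) minus[of v] by auto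
  then show ?thesis
    using norm2_inner_cases[OF v(2) S_norm[OF in_S[OF assms(2)]] coord[OF v(1) assms(2)]] by blast
qed

text \<open>Besides the frame vectors and their negatives, S contains the reflection of each norm 2 vector
  of L in the first frame vector not orthogonal to it. The set of frame vectors not orthogonal to
  it is unchanged by the reflection, so this map is injective.\<close>

lemma card_S_ge: "2 * n + card (vectors_of_norm L 2) \<le> card S"
proof -
  define supp where "supp = (\<lambda>v. {i \<in> {1..n}. v \<bullet> \<beta> i \<noteq> 0})"
  define r where "r = (\<lambda>v. v - (\<beta> (Min (supp v)) \<bullet> v) *\<^sub>R \<beta> (Min (supp v)))"
  have fin: "finite (supp v)" for v by (simp add: supp_def)
  have d: "\<beta> i \<bullet> \<beta> j = (if i = j then 2 else 0)" if "i \<in> {1..n}" "j \<in> {1..n}" for i j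
    using basis that by (simp add: norm2_orthogonal_basis_def)
  have supp_Min: "Min (supp v) \<in> supp v" "Min (supp v) \<in> {1..n}" if v: "v \<in> vectors_of_norm L 2" for v
  proof -
    have "v \<bullet> v = 2" "v \<in> span (\<beta> ` {1..n})" using v spans by (auto simp: vectors_of_norm_def)
    then have "(\<Sum>i\<in>{1..n}. (v \<bullet> \<beta> i) * (v \<bullet> \<beta> i)) \<noteq> 0"
      using norm2_basis_inner[OF basis, of v v] by auto
    then obtain i where "i \<in> {1..n}" "(v \<bullet> \<beta> i) * (v \<bullet> \<beta> i) \<noteq> 0" by (rule sum.not_neutral_contains_not_neutral)
    then have "supp v \<noteq> {}" by (auto simp: supp_def)
    then show "Min (supp v) \<in> supp v" by (rule Min_in[OF fin])
    then show "Min (supp v) \<in> {1..n}" by (simp add: supp_def)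
  qed
  \<comment> \<open>As the frame is orthogonal, reflecting in one of its vectors only changes the
    sign of that coordinate.\<close>
  have r_inner: "r v \<bullet> \<beta> j = (if j = Min (supp v) then - (v \<bullet> \<beta> j) else v \<bullet> \<beta> j)"
    if "v \<in> vectors_of_norm L 2" "j \<in> {1..n}" for v j
  proof -
    have "r v \<bullet> \<beta> j = v \<bullet> \<beta> j - (v \<bullet> \<beta> (Min (supp v))) * (\<beta> (Min (supp v)) \<bullet> \<beta> j)"
      by (simp add: r_def inner_diff_left inner_commute[of v])
    then show ?thesis using d[OF supp_Min(2)[OF that(1)] that(2)] by auto
  qed
  have r_supp: "supp (r v) = supp v" if "v \<in> vectors_of_norm L 2" for v
  proof -
    have "r v \<bullet> \<beta> j \<noteq> 0 \<longleftrightarrow> v \<bullet> \<beta> j \<noteq> 0" if "j \<in> {1..n}" for j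
      using r_inner[OF \<open>v \<in> vectors_of_norm L 2\<close> that] by simp
    then show ?thesis unfolding supp_def by blast
  qed
  \<comment> \<open>The minimum of the support is unchanged, so the second application reflects in
    the same frame vector.\<close>
  have r_r: "r (r v) = v" if v: "v \<in> vectors_of_norm L 2" for v
  proof -
    let ?b = "\<beta> (Min (supp v))"
    have "?b \<bullet> r v = - (?b \<bullet> v)" using r_inner[OF v supp_Min(2)[OF v]] by (simp add: inner_commute)
    moreover have "r w = w - (\<beta> (Min (supp w)) \<bullet> w) *\<^sub>R \<beta> (Min (supp w))" for w by (simp add: r_def)
    ultimately have "r (r v) = r v + (?b \<bullet> v) *\<^sub>R ?b" using r_supp[OF v] by (metis diff_minus_eq_add scaleR_minus_left)
    then show ?thesis by (simp add: r_def)
  qed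
  then have inj: "inj_on r (vectors_of_norm L 2)" by (metis inj_onI)
  have r_S: "r ` vectors_of_norm L 2 \<subseteq> S"
  proof
    fix x assume "x \<in> r ` vectors_of_norm L 2"
    then obtain v where v: "v \<in> vectors_of_norm L 2" "x = r v" by auto
    have "\<beta> (Min (supp v)) \<bullet> v = 1 \<or> \<beta> (Min (supp v)) \<bullet> v = -1"
      using L_frame_inner[OF v(1) supp_Min(2)[OF v(1)]] supp_Min(1)[OF v(1)]
      by (auto simp: supp_def inner_commute)
    then show "x \<in> S"
      unfolding v(2) r_def by (rule reflect_L[OF in_S[OF supp_Min(2)[OF v(1)]] v(1)])
  qed
  \<comment> \<open>Reflected vectors have coordinates -1, 0 or 1 only, whereas a frame vector has
    coordinate 2 at its own index. Hence the images avoid the frame and its negatives.\<close>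
  have r_frame: "\<bar>r v \<bullet> \<beta> i\<bar> \<noteq> 2" if "v \<in> vectors_of_norm L 2" "i \<in> {1..n}" for v i
    using r_inner[OF that] L_frame_inner[OF that] by auto
  define P where "P = \<beta> ` {1..n}"
  define M where "M = uminus ` P"
  have P_S: "P \<subseteq> S" and M_S: "M \<subseteq> S" using in_S S_minus by (auto simp: P_def M_def)
  have cards: "card P = n" "card M = n"
    using norm2_basis_independent(2)[OF basis] by (simp_all add: P_def M_def card_image)
  have PM: "P \<inter> M = {}"
  proof -
    have "\<beta> i \<noteq> - \<beta> j" if "i \<in> {1..n}" "j \<in> {1..n}" for i j
    proof
      assume "\<beta> i = - \<beta> j"
      then have "\<beta> i \<bullet> \<beta> j = - 2" using d[of j j] that by simp
      then show False using d[OF that] by (simp split: if_splits)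
    qed
    then show ?thesis by (auto simp: P_def M_def)
  qed
  have "(P \<union> M) \<inter> r ` vectors_of_norm L 2 = {}"
  proof -
    have "r v \<noteq> \<beta> i" "r v \<noteq> - \<beta> i" if "v \<in> vectors_of_norm L 2" "i \<in> {1..n}" for v i
      using r_frame[OF that] d[OF that(2,2)] by auto
    then show ?thesis by (fastforce simp: P_def M_def)
  qed
  moreover have "finite (P \<union> M)" "finite (r ` vectors_of_norm L 2)"
    using finite_S P_S M_S r_S by (meson finite_UnI finite_subset)+
  ultimately have "card ((P \<union> M) \<union> r ` vectors_of_norm L 2) = card (P \<union> M) + card (vectors_of_norm L 2)"
    by (simp add: card_Un_disjoint card_image[OF inj])
  moreover have "card (P \<union> M) = n + n"
    using PM cards finite_S P_S M_S by (metis card_Un_disjoint finite_subset)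
  moreover have "card ((P \<union> M) \<union> r ` vectors_of_norm L 2) \<le> card S"
    using P_S M_S r_S by (intro card_mono finite_S) auto
  ultimately show ?thesis by simp
qed

end

section \<open>The two implications\<close>

lemma R_set_nonempty_imp_construction_B:
  fixes \<alpha> :: "nat \<Rightarrow> 'b::euclidean_space" and L :: "'a::euclidean_space set"
  assumes \<alpha>: "norm2_orthogonal_basis n \<alpha>" and L: "even_lattice_of_rank n L"
    and R: "R_set n L \<noteq> {}"
  shows "obtained_by_construction_B n \<alpha> L"
proof -
  obtain B where B: "independent B" "card B = n" "L = group_closure B"
    and even: "\<And>v. v \<in> L \<Longrightarrow> \<exists>k::int. v \<bullet> v = 2 * of_int k"
    using L by (auto simp: even_lattice_of_rank_def lattice_of_rank_def)
  interpret even_group L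
    by unfold_locales (use even in \<open>auto simp: B intro: group_closure.diff\<close>)
  have LB: "L \<subseteq> span B" using group_closure_subset_span B(3) by blast
  have BL: "B \<subseteq> L" unfolding B(3) by (auto intro: group_closure.base)
  have spanL: "span L = span B" using LB BL by (metis span_eq span_superset subset_trans)
  obtain x where x: "x \<in> dual_lattice L" "x \<in> half_lattice L"
    and card: "2 * n + card (vectors_of_norm L 2) \<le> card (vectors_of_norm (coset_of x L) 2)"
    using R by (auto simp: R_set_def)
  interpret glued_group L x
  proof
    show "x + x \<in> L" using x(2) by (auto simp: half_lattice_def scaleR_2[symmetric])
    show "x \<bullet> v \<in> \<int>" if "v \<in> L" for v using x(1) that by (simp add: dual_lattice_def)
  qed
  have fin: "finite (vectors_of_norm L 2)"
    using integral BL LB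
    by (intro finite_norm2_integral[OF independent_imp_finite[OF B(1)]]) (auto simp: vectors_of_norm_def)
  obtain \<beta> where \<beta>: "norm2_orthogonal_basis n \<beta>" "\<beta> ` {1..n} \<subseteq> S"
    using orthogonal_frame_exists[OF fin, of n n] card unfolding S_eq_coset by auto
  interpret F: framed_group L x n \<beta>
  proof
    have "x \<in> span B" using x(1) by (simp add: dual_lattice_def spanL)
    have "S \<subseteq> span B"
    proof
      fix a assume "a \<in> S"
      then have "x + (a - x) \<in> span B" using \<open>x \<in> span B\<close> LB by (intro span_add) (auto simp: S_def)
      then show "a \<in> span B" by simp
    qed
    then have "\<beta> ` {1..n} \<subseteq> span B" using \<beta>(2) by blast
    \<comment> \<open>The n frame vectors are independent in a space of dimension n, hence span
      it.\<close>
    moreover have "dim (span B) \<le> card (\<beta> ` {1..n})"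
      using B(1,2) norm2_basis_independent(2)[OF \<beta>(1)] by (simp add: card_image dim_eq_card_independent)
    ultimately have "span B \<subseteq> span (\<beta> ` {1..n})"
      by (rule card_ge_dim_independent[OF _ norm2_basis_independent(1)[OF \<beta>(1)]])
    then show "L \<subseteq> span (\<beta> ` {1..n})" using LB by blast
    \<comment> \<open>Otherwise the coset would be \<open>L\<close> itself and have no excess,
      although 2n is positive.\<close>
    show "x \<notin> L" if "n > 0"
    proof
      assume "x \<in> L"
      then have "S = vectors_of_norm L 2"
        unfolding S_def vectors_of_norm_def using add[of _ x] diff[of _ x] by fastforce
      then show False using card that by (simp add: S_eq_coset)
    qed
  qed (rule \<beta>)+
  obtain \<gamma> where \<gamma>: "framed_group L x n \<gamma>" and sum4: "\<And>v. v \<in> L \<Longrightarrow> v \<bullet> (\<Sum>i\<in>{1..n}. \<gamma> i) / 4 \<in> \<int>"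
    using F.signs_exist by blast
  interpret G: framed_group L x n \<gamma> by (rule \<gamma>)
  have odd_coords_subset: "G.odd_coords ` L \<subseteq> Pow {1..n}" by (auto simp: G.odd_coords_def)
  have "isometric_lattices L (L_B n \<alpha> (G.odd_coords ` L))"
    using isometric_L_B[OF G.basis \<alpha> odd_coords_subset] G.eq_L_B[OF sum4] by simp
  then show ?thesis
    unfolding obtained_by_construction_B_def using G.linear_code_odd_coords by blast
qed

text \<open>Here \<open>\<alpha> 1\<close> serves as the coset representative and
  \<open>\<alpha>\<close> itself as the frame.\<close>

lemma framed_group_L_B:
  assumes \<alpha>: "norm2_orthogonal_basis n \<alpha>" and "n > 0" and C: "linear_code n C"
    and even: "\<And>v. v \<in> L_B n \<alpha> C \<Longrightarrow> \<exists>k::int. v \<bullet> v = 2 * of_int k"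
  shows "framed_group (L_B n \<alpha> C) (\<alpha> 1) n \<alpha>"
proof -
  let ?X = "{(1/2) *\<^sub>R (\<Sum>i\<in>c. \<alpha> i) | c. c \<in> C} \<union> {\<alpha> i + \<alpha> j | i j. i \<in> {1..n} \<and> j \<in> {1..n}}"
  have C': "C \<subseteq> Pow {1..n}" using C by (simp add: linear_code_def)
  have one: "1 \<in> {1..n}" using \<open>n > 0\<close> by simp
  have d: "\<alpha> i \<bullet> \<alpha> j = (if i = j then 2 else 0)" if "i \<in> {1..n}" "j \<in> {1..n}" for i j
    using \<alpha> that by (simp add: norm2_orthogonal_basis_def)
  have gen: "?X \<subseteq> L_B n \<alpha> C" unfolding L_B_def by (auto intro: group_closure.base)
  interpret even_group "L_B n \<alpha> C"
    by unfold_locales (use even in \<open>auto simp: L_B_def intro: group_closure.diff\<close>)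
  have sum_mem: "\<alpha> i + \<alpha> j \<in> L_B n \<alpha> C" if "i \<in> {1..n}" "j \<in> {1..n}" for i j
    using gen that by blast
  have code_inner: "((1/2) *\<^sub>R (\<Sum>i\<in>c. \<alpha> i)) \<bullet> \<alpha> j = (if j \<in> c then 1 else 0)"
    if "c \<in> C" "j \<in> {1..n}" for c j
  proof -
    have "c \<subseteq> {1..n}" using that(1) C' by blast
    then show ?thesis
      using norm2_basis_inner_sum[OF \<alpha> that(2), of c "\<lambda>_. 1/2"] by (simp add: scaleR_sum_right)
  qed
  have dual: "\<alpha> 1 \<bullet> v \<in> \<int>" if "v \<in> L_B n \<alpha> C" for v
  proof -
    interpret D: additive_subgroup "{v. \<alpha> 1 \<bullet> v \<in> \<int>}"
      by unfold_locales (auto simp: inner_diff_right)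
    have "\<alpha> 1 \<bullet> ((1/2) *\<^sub>R (\<Sum>i\<in>c. \<alpha> i)) \<in> \<int>" if "c \<in> C" for c
      by (subst inner_commute, subst code_inner[OF that one]) simp
    moreover have "\<alpha> 1 \<bullet> (\<alpha> i + \<alpha> j) \<in> \<int>" if "i \<in> {1..n}" "j \<in> {1..n}" for i j
      using d[OF one that(1)] d[OF one that(2)] by (auto simp: inner_add_right)
    ultimately have "?X \<subseteq> {v. \<alpha> 1 \<bullet> v \<in> \<int>}" by blast
    then show ?thesis using that D.group_closure_subset unfolding L_B_def by blast
  qed
  \<comment> \<open>Divisibility of the coordinate sum by 4 separates the lattice from
    \<open>\<alpha> 1\<close>, whose sum is 2. On half a codeword sum the value is the weight, and
    the norm, being half the weight, is even.\<close>
  have sum4: "v \<bullet> (\<Sum>j\<in>{1..n}. \<alpha> j) / 4 \<in> \<int>" if "v \<in> L_B n \<alpha> C" for v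
  proof -
    let ?D = "{v. v \<bullet> (\<Sum>j\<in>{1..n}. \<alpha> j) / 4 \<in> \<int>}"
    interpret D: additive_subgroup ?D
      by unfold_locales (auto simp: inner_diff_left diff_divide_distrib)
    have "(1/2) *\<^sub>R (\<Sum>i\<in>c. \<alpha> i) \<in> ?D" if c: "c \<in> C" for c
    proof -
      let ?v = "(1/2) *\<^sub>R (\<Sum>i\<in>c. \<alpha> i)"
      have sub: "c \<subseteq> {1..n}" using c C' by blast
      have "?v \<bullet> (\<Sum>j\<in>{1..n}. \<alpha> j) = (\<Sum>j\<in>{1..n}. if j \<in> c then 1 else 0)"
        unfolding inner_sum_right by (intro sum.cong refl code_inner c)
      then have total: "?v \<bullet> (\<Sum>j\<in>{1..n}. \<alpha> j) = card c"
        using sub by (simp add: sum.If_cases Int_absorb1)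
      have "?v \<bullet> ?v = (1/2) * (\<Sum>j\<in>c. ?v \<bullet> \<alpha> j)" by (simp only: inner_scaleR_right inner_sum_right)
      also have "(\<Sum>j\<in>c. ?v \<bullet> \<alpha> j) = (\<Sum>j\<in>c. 1)"
      proof (intro sum.cong refl)
        fix j assume "j \<in> c"
        then show "?v \<bullet> \<alpha> j = 1" using code_inner[OF c] sub by auto
      qed
      finally have "?v \<bullet> ?v = card c / 2" by simp
      moreover have "\<exists>k::int. ?v \<bullet> ?v = 2 * of_int k" using gen c by (intro even) blast
      ultimately obtain k :: int where "card c / 2 = 2 * real_of_int k" by auto
      then have "real (card c) / 4 = of_int k" by simp
      then show ?thesis unfolding mem_Collect_eq total by simp
    qed
    moreover have "\<alpha> i + \<alpha> j \<in> ?D" if "i \<in> {1..n}" "j \<in> {1..n}" for i j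
    proof -
      have "\<alpha> i \<bullet> (\<Sum>j\<in>{1..n}. \<alpha> j) = 2" if "i \<in> {1..n}" for i
        using norm2_basis_inner_sum[OF \<alpha> that order.refl, of "\<lambda>_. 1"] that by (simp add: inner_commute)
      then show ?thesis using that by (simp add: inner_add_left)
    qed
    ultimately have "?X \<subseteq> ?D" by blast
    then show ?thesis using that D.group_closure_subset unfolding L_B_def by blast
  qed
  show ?thesis
  proof
    show "\<alpha> 1 + \<alpha> 1 \<in> L_B n \<alpha> C" by (rule sum_mem[OF one one])
    show "norm2_orthogonal_basis n \<alpha>" by (rule \<alpha>)
    show "L_B n \<alpha> C \<subseteq> span (\<alpha> ` {1..n})" by (rule L_B_subset_span[OF C'])
    show "\<alpha> 1 \<notin> L_B n \<alpha> C"
    proof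
      assume "\<alpha> 1 \<in> L_B n \<alpha> C"
      then have "\<alpha> 1 \<bullet> (\<Sum>j\<in>{1..n}. \<alpha> j) / 4 \<in> \<int>" by (rule sum4)
      moreover have "\<alpha> 1 \<bullet> (\<Sum>j\<in>{1..n}. \<alpha> j) = 2"
        using norm2_basis_inner_sum[OF \<alpha> one order.refl, of "\<lambda>_. 1"] one by (simp add: inner_commute)
      ultimately show False using half_of_int_in_Ints_iff[of 1] by simp
    qed
    interpret glued_group "L_B n \<alpha> C" "\<alpha> 1"
      by unfold_locales (use sum_mem[OF one one] dual in auto)
    show "\<alpha> ` {1..n} \<subseteq> S"
    proof
      fix a assume "a \<in> \<alpha> ` {1..n}"
      then obtain i where i: "i \<in> {1..n}" "a = \<alpha> i" by blast
      have "(\<alpha> i + \<alpha> 1) - (\<alpha> 1 + \<alpha> 1) \<in> L_B n \<alpha> C" by (intro diff sum_mem i one)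
      then show "a \<in> S" unfolding S_def using i d[OF i(1) i(1)] by simp
    qed
  qed (rule dual)
qed

lemma construction_B_imp_R_set_nonempty:
  fixes \<alpha> :: "nat \<Rightarrow> 'b::euclidean_space" and L :: "'a::euclidean_space set"
  assumes \<alpha>: "norm2_orthogonal_basis n \<alpha>" and L: "even_lattice_of_rank n L"
    and con: "obtained_by_construction_B n \<alpha> L"
  shows "R_set n L \<noteq> {}"
proof (cases "n = 0")
  case True
  \<comment> \<open>In rank 0 there is no \<open>\<alpha> 1\<close>, but the zero coset qualifies
    since 2n = 0.\<close>
  have "0 \<in> L" using L by (auto simp: even_lattice_of_rank_def lattice_of_rank_def)
  then have "0 \<in> dual_lattice L" "0 \<in> half_lattice L"
    by (auto simp: dual_lattice_def half_lattice_def span_zero intro: image_eqI[of _ _ 0])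
  moreover have "coset_of 0 L = L" by (simp add: coset_of_def)
  ultimately show ?thesis using True by (auto simp: R_set_def)
next
  case False
  obtain C f where C: "linear_code n C" and f: "bij_betw f L (L_B n \<alpha> C)"
    and inner: "\<And>u v. u \<in> L \<Longrightarrow> v \<in> L \<Longrightarrow> f u \<bullet> f v = u \<bullet> v"
    using con by (auto simp: obtained_by_construction_B_def isometric_lattices_def)
  let ?N = "L_B n \<alpha> C"
  have img: "f ` L = ?N" and inj: "inj_on f L" using f by (auto simp: bij_betw_def)
  have "\<exists>k::int. v \<bullet> v = 2 * of_int k" if "v \<in> ?N" for v
    using that L inner unfolding img[symmetric] even_lattice_of_rank_def by fastforce
  then interpret framed_group ?N "\<alpha> 1" n \<alpha> using \<alpha> False C by (intro framed_group_L_B) auto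
  \<comment> \<open>The isometry is known on \<open>L\<close> only, and \<open>\<alpha> 1\<close> is
    outside its image. Half a preimage of \<open>\<alpha> 1 + \<alpha> 1\<close> replaces it and has
    matching inner products with \<open>L\<close>.\<close>
  obtain u where u: "u \<in> L" "f u = \<alpha> 1 + \<alpha> 1" using twice img by (metis imageE)
  define x where "x = (1/2) *\<^sub>R u"
  have x_inner: "x \<bullet> v = \<alpha> 1 \<bullet> f v" if "v \<in> L" for v
    using inner[OF u(1) that] by (simp add: x_def u(2) inner_add_left)
  have x_x: "x \<bullet> x = 2"
    using x_inner[OF u(1)] S_norm[OF in_S[of 1]] False by (simp add: x_def u(2) inner_add_right)
  have \<alpha>1: "\<alpha> 1 \<bullet> \<alpha> 1 = 2" using S_norm[OF in_S[of 1]] False by simp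
  have norm: "(\<alpha> 1 + f v) \<bullet> (\<alpha> 1 + f v) = (x + v) \<bullet> (x + v)" if "v \<in> L" for v
    using x_inner[OF that] inner[OF that that] x_x \<alpha>1 by (simp add: inner_add inner_commute)
  \<comment> \<open>This set indexes the norm 2 vectors of both cosets, through \<open>x + v\<close>
    and through \<open>\<alpha> 1 + f v\<close>.\<close>
  define V where "V = {v \<in> L. (x + v) \<bullet> (x + v) = 2}"
  have "vectors_of_norm (coset_of x L) 2 = (\<lambda>v. x + v) ` V"
    by (auto simp: vectors_of_norm_def coset_of_def V_def)
  then have "card (vectors_of_norm (coset_of x L) 2) = card V" by (simp add: card_image)
  moreover have "S = (\<lambda>v. \<alpha> 1 + f v) ` V"
    unfolding S_eq_coset using norm by (auto simp: vectors_of_norm_def coset_of_def V_def img[symmetric])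
  then have "card S = card V"
    using inj by (simp add: card_image inj_on_def V_def)
  moreover have "vectors_of_norm ?N 2 = f ` vectors_of_norm L 2"
    using inner by (auto simp: vectors_of_norm_def img[symmetric])
  then have "card (vectors_of_norm ?N 2) = card (vectors_of_norm L 2)"
    using inj by (simp add: card_image inj_on_def vectors_of_norm_def)
  ultimately have "2 * n + card (vectors_of_norm L 2) \<le> card (vectors_of_norm (coset_of x L) 2)"
    using card_S_ge by simp
  moreover have "x \<in> half_lattice L" using u(1) by (simp add: x_def half_lattice_def)
  moreover have "x \<in> dual_lattice L"
    unfolding dual_lattice_def
  proof (intro CollectI conjI ballI)
    show "x \<in> span L" unfolding x_def using u(1) by (intro span_scale span_base)
    show "x \<bullet> v \<in> \<int>" if "v \<in> L" for v using x_inner[OF that] dual img that by auto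
  qed
  ultimately show ?thesis by (auto simp: R_set_def)
qed

theorem theorem2p2:
  fixes n :: nat
    and \<alpha> :: "nat \<Rightarrow> 'b::euclidean_space"
    and L :: "'a::euclidean_space set"
  assumes "norm2_orthogonal_basis n \<alpha>"
    and "even_lattice_of_rank n L"
  shows "obtained_by_construction_B n \<alpha> L \<longleftrightarrow> R_set n L \<noteq> {}"
  using construction_B_imp_R_set_nonempty[OF assms] R_set_nonempty_imp_construction_B[OF assms]
  by blast

end
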